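(* Let $\{z[t]\}$ be the iterates of the synchronous algorithm: $z[0]=z[-1]$ is arbitrary in $\mathcal{Z}$ and for $t\ge1$ $$\zeta=z[t-1]+\frac{t-2}{t+1}\big(z[t-1]-z[t-2]\big),\qquad z[t]=\mathrm{P}_{\mathcal{Z}}\Big(\zeta-\frac1{L_F}\nabla F(\zeta)\Big),$$ with $L_F=2+2\delta_{\max}+\max_{i\in\mathcal{V}}|\mathcal{A}_i|$. Let $F^\star$ be the optimal value and $z^\star$ a minimizer of $F$ over $\mathcal{Z}$. Then for all $t\ge1$ $$F(z[t])-F^\star\le\frac{2L_F}{(t+1)^2}\|z[0]-z^\star\|^2 .$$
   Context: Network: $\mathcal{G}=(\mathcal{V},\mathcal{E})$ is a finite undirected graph, $\mathcal{V}=\{1,\dots,n\}$, $i\sim j$ denotes an edge, and $\delta_{\max}$ is the maximum node degree. There is a finite set of anchors $\mathcal{A}=\{1,\dots,m\}$ with known positions $a_k\in\mathbb{R}^p$ ($p=2$ or $3$), and $\mathcal{A}_i\subset\mathcal{A}$ is the subset of anchors with a measured range to node $i$. Given data: range measurements $d_{ij}\ge 0$ for $i\sim j$ and $r_{ik}\ge0$ for $i\in\mathcal{V}$, $k\in\mathcal{A}_i$; Huber radii $D_{ij}>0$ and $R_{ik}>0$. Huber function: $h_\delta(s)=s^2$ if $|s|\le\delta$, $h_\delta(s)=2\delta|s|-\delta^2$ if $|s|\ge\delta$; $\psi_\delta(u)=h_\delta(\|u\|)$. Variables: $z=(x,y,w)$ with $x=(x_i)_{i\in\mathcal{V}}$,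 $y=(y_{ij})_{i\sim j}$ (one variable per edge, with a fixed orientation of each edge), $w=(w_{ik})_{i\in\mathcal{V},k\in\mathcal{A}_i}$, all entries in $\mathbb{R}^p$. Cost and constraint set: $$F(z)=\sum_{i\sim j}\tfrac12\psi_{D_{ij}}(x_i-x_j-y_{ij})+\sum_{i\in\mathcal{V}}\sum_{k\in\mathcal{A}_i}\tfrac12\psi_{R_{ik}}(x_i-a_k-w_{ik}),$$ $$\mathcal{Z}=\{(x,y,w):\|y_{ij}\|\le d_{ij}\ (i\sim j),\ \|w_{ik}\|\le r_{ik}\ (i\in\mathcal{V},k\in\mathcal{A}_i)\}.$$ $\mathrm{P}_{\mathcal{Z}}$ is the orthogonal projection onto the closed convex set $\mathcal{Z}$. $F$ is differentiable. *)

theory Defs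
  imports "HOL-Analysis.Analysis"
begin

definition gradient :: "('a::real_inner \<Rightarrow> real) \<Rightarrow> 'a \<Rightarrow> 'a" where
  "gradient f x = (THE g. GDERIV f x :> g)"

definition simple_graph :: "('v \<Rightarrow> 'v \<Rightarrow> bool) \<Rightarrow> bool" where
  "simple_graph adj \<longleftrightarrow> symp adj \<and> irreflp adj"

text \<open>An orientation contains exactly one of the two ordered pairs of each undirected edge, so a sum
  over edges, or a family with one entry per edge, is indexed by an orientation.\<close>

definition orientation :: "('v \<Rightarrow> 'v \<Rightarrow> bool) \<Rightarrow> ('v \<times> 'v) set \<Rightarrow> bool" where
  "orientation adj E \<longleftrightarrow> (\<forall>i j. adj i j \<longleftrightarrow> (i, j) \<in> E \<or> (j, i) \<in> E) \<and> asym E"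

definition node_degree :: "('v \<Rightarrow> 'v \<Rightarrow> bool) \<Rightarrow> 'v \<Rightarrow> nat" where
  "node_degree adj i = card {j. adj i j}"

definition max_degree :: "('v::finite \<Rightarrow> 'v \<Rightarrow> bool) \<Rightarrow> nat" where
  "max_degree adj = Max (range (node_degree adj))"

definition L_F :: "('v::finite \<Rightarrow> 'v \<Rightarrow> bool) \<Rightarrow> ('v \<Rightarrow> 'k set) \<Rightarrow> real" where
  "L_F adj \<A> = 2 + 2 * real (max_degree adj) + real (Max (range (\<lambda>i. card (\<A> i))))"

definition huber :: "real \<Rightarrow> real \<Rightarrow> real" where
  "huber \<delta> s = (if \<bar>s\<bar> \<le> \<delta> then s\<^sup>2 else 2 * \<delta> * \<bar>s\<bar> - \<delta>\<^sup>2)"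

definition huber_norm :: "real \<Rightarrow> 'a::real_normed_vector \<Rightarrow> real" where
  "huber_norm \<delta> u = huber \<delta> (norm u)"

text \<open>The variable \<open>z = (x, y, w)\<close>. The families \<open>y\<close> and \<open>w\<close> are indexed by an arbitrary (possibly
  empty) set \<open>E\<close> of oriented edges and by the pairs \<open>(i, k)\<close> with \<open>k \<in> \<A> i\<close>; here they are padded
  by zeros to vectors indexed by all pairs. Neither the cost nor its gradient sees the padding
  entries, and the constraint set fixes them to 0, so that norms, gradients and projections agree
  with those of the unpadded space.\<close>

type_synonym ('p, 'v, 'k) var =
  "((real^'p)^'v) \<times> ((real^'p)^('v \<times> 'v)) \<times> ((real^'p)^('v \<times> 'k))"

definition cost ::
  "('v \<times> 'v) set \<Rightarrow> ('v \<Rightarrow> 'k set) \<Rightarrow> ('k \<Rightarrow> real^'p) \<Rightarrow> ('v \<Rightarrow> 'v \<Rightarrow> real) \<Rightarrow> ('v \<Rightarrow> 'k \<Rightarrow> real) \<Rightarrow>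
    ('p::finite, 'v::finite, 'k::finite) var \<Rightarrow> real" where
  "cost E \<A> a D R = (\<lambda>(x, y, w).
      (\<Sum>(i, j)\<in>E. 1/2 * huber_norm (D i j) (x $ i - x $ j - y $ (i, j)))
    + (\<Sum>i\<in>UNIV. \<Sum>k\<in>\<A> i. 1/2 * huber_norm (R i k) (x $ i - a k - w $ (i, k))))"

definition feasible ::
  "('v \<times> 'v) set \<Rightarrow> ('v \<Rightarrow> 'k set) \<Rightarrow> ('v \<Rightarrow> 'v \<Rightarrow> real) \<Rightarrow> ('v \<Rightarrow> 'k \<Rightarrow> real) \<Rightarrow>
    ('p::finite, 'v::finite, 'k::finite) var set" where
  "feasible E \<A> d r = {(x, y, w).
      (\<forall>i j. (i, j) \<in> E \<longrightarrow> norm (y $ (i, j)) \<le> d i j) \<and>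
      (\<forall>i j. (i, j) \<notin> E \<longrightarrow> y $ (i, j) = 0) \<and>
      (\<forall>i k. k \<in> \<A> i \<longrightarrow> norm (w $ (i, k)) \<le> r i k) \<and>
      (\<forall>i k. k \<notin> \<A> i \<longrightarrow> w $ (i, k) = 0)}"

text \<open>The time index is an integer because the iteration starts from \<open>z (-1)\<close> and \<open>z 0\<close>.\<close>

definition sync_iterates ::
  "('a::euclidean_space \<Rightarrow> real) \<Rightarrow> 'a set \<Rightarrow> real \<Rightarrow> (int \<Rightarrow> 'a) \<Rightarrow> bool" where
  "sync_iterates F Z L z \<longleftrightarrow>
     z 0 \<in> Z \<and> z (-1) = z 0 \<and>
     (\<forall>t\<ge>1. let \<zeta> = z (t - 1) + ((real_of_int t - 2) / (real_of_int t + 1)) *\<^sub>R (z (t - 1) - z (t - 2))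
            in z t = closest_point Z (\<zeta> - (1 / L) *\<^sub>R gradient F \<zeta>))"

end

theory Submission
  imports Defs
begin

text \<open>
  The bound is the \<open>O(1/t\<^sup>2)\<close> rate of Nesterov's accelerated projected gradient method. Two things
  have to be shown: that rate for an abstract smooth convex function, and that \<open>L_F\<close> is an
  admissible smoothness constant for the localization cost.

  For a function \<open>f\<close> with candidate gradient \<open>G\<close>, everything rests on one two-sided estimate,
  \<open>0 \<le> f v - f u - G u \<bullet> (v - u) \<le> q (v - u) / 2\<close>. The left half is convexity, the right half is the
  descent inequality, and for \<open>q h = L * (norm h)\<^sup>2\<close> both together force \<open>f\<close> to be differentiable with
  gradient \<open>G\<close> (\<open>gradient_bregman_bounded\<close>). Keeping a general \<open>q\<close> makes the estimate stable under
  affine substitutions and sums without loss, so the spectral estimate is made only once, at the end.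

  \<^item> Rate (\<open>accelerated_projected_gradient\<close>): with \<open>\<tau> k = (k + 1) / 2\<close> the quantity
    \<open>(\<tau> k)\<^sup>2 * (f (z k) - f s) + L / 2 * (norm (s + (\<tau> k - 1) *\<^sub>R z (k - 1) - \<tau> k *\<^sub>R z k))\<^sup>2\<close> does not
    increase. To see this, the growth inequality of one projected gradient step is evaluated at the convex
    combination of the previous iterate and the minimizer with weight \<open>1 / \<tau> k\<close>
    (\<open>accelerated_step\<close>). The momentum factor \<open>(k - 2) / (k + 1)\<close> is exactly what makes the distance
    terms of consecutive steps telescope.

  \<^item> Smoothness (\<open>cost_bregman_bounded\<close>): half the Huber function is the maximum of
    \<open>g \<bullet> u - (norm g)\<^sup>2 / 2\<close> over the ball of radius \<open>\<delta>\<close>, attained at the projection of \<open>u\<close>. Hence it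
    satisfies the estimate with \<open>q h = (norm h)\<^sup>2\<close>. The cost composes such functions with the maps
    \<open>x i - x j - y (i, j)\<close> and \<open>x i - w (i, k)\<close>, and \<open>measurement_maps_bound\<close> bounds the sum of the squared
    norms of these maps by \<open>L_F\<close>: a node appears in as many edges as its degree, and a weighted
    Young inequality separates \<open>x\<close> from \<open>y\<close> and \<open>w\<close>.
\<close>

section \<open>Bregman divergences bounded by a quadratic\<close>

definition bregman_bounded :: "('a::real_inner \<Rightarrow> real) \<Rightarrow> ('a \<Rightarrow> 'a) \<Rightarrow> ('a \<Rightarrow> real) \<Rightarrow> bool" where
  "bregman_bounded f G q \<longleftrightarrow>
     (\<forall>u v. 0 \<le> f v - f u - G u \<bullet> (v - u) \<and> f v - f u - G u \<bullet> (v - u) \<le> q (v - u) / 2)"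

lemma bregman_boundedD:
  assumes "bregman_bounded f G q"
  shows "f u + G u \<bullet> (v - u) \<le> f v"
    and "f v \<le> f u + G u \<bullet> (v - u) + q (v - u) / 2"
proof -
  have "0 \<le> f v - f u - G u \<bullet> (v - u) \<and> f v - f u - G u \<bullet> (v - u) \<le> q (v - u) / 2"
    using assms unfolding bregman_bounded_def by blast
  then show "f u + G u \<bullet> (v - u) \<le> f v"
    and "f v \<le> f u + G u \<bullet> (v - u) + q (v - u) / 2"
    by linarith+
qed

lemma bregman_bounded_mono:
  assumes "bregman_bounded f G q" and "\<And>h. q h \<le> q' h"
  shows "bregman_bounded f G q'"
  unfolding bregman_bounded_def
proof (intro allI)
  fix u v
  show "0 \<le> f v - f u - G u \<bullet> (v - u) \<and> f v - f u - G u \<bullet> (v - u) \<le> q' (v - u) / 2"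
    using bregman_boundedD(1)[OF assms(1), of u v] bregman_boundedD(2)[OF assms(1), of v u] assms(2)[of "v - u"] by linarith
qed

lemma bregman_bounded_add:
  assumes "bregman_bounded f G q" and "bregman_bounded f' G' q'"
  shows "bregman_bounded (\<lambda>u. f u + f' u) (\<lambda>u. G u + G' u) (\<lambda>h. q h + q' h)"
  unfolding bregman_bounded_def
proof (intro allI)
  fix u v
  show "0 \<le> f v + f' v - (f u + f' u) - (G u + G' u) \<bullet> (v - u) \<and>
        f v + f' v - (f u + f' u) - (G u + G' u) \<bullet> (v - u) \<le> (q (v - u) + q' (v - u)) / 2"
    using bregman_boundedD(1)[OF assms(1), of u v] bregman_boundedD(2)[OF assms(1), of v u] bregman_boundedD(1)[OF assms(2), of u v] bregman_boundedD(2)[OF assms(2), of v u]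
    by (simp add: inner_add_left add_divide_distrib)
qed

lemma bregman_bounded_sum:
  assumes "finite C" and "\<And>c. c \<in> C \<Longrightarrow> bregman_bounded (f c) (G c) (q c)"
  shows "bregman_bounded (\<lambda>u. \<Sum>c\<in>C. f c u) (\<lambda>u. \<Sum>c\<in>C. G c u) (\<lambda>h. \<Sum>c\<in>C. q c h)"
  using assms
proof (induction C rule: finite_induct)
  case empty
  then show ?case by (simp add: bregman_bounded_def)
next
  case (insert c C)
  then show ?case by (simp add: bregman_bounded_add)
qed

lemma bregman_bounded_affine:
  fixes A :: "'a::euclidean_space \<Rightarrow> 'b::euclidean_space"
  assumes "bregman_bounded f G q" and "linear A"
  shows "bregman_bounded (\<lambda>u. f (A u - b)) (\<lambda>u. adjoint A (G (A u - b))) (\<lambda>h. q (A h))"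
  unfolding bregman_bounded_def
proof (intro allI)
  fix u v
  have *: "adjoint A (G (A u - b)) \<bullet> (v - u) = G (A u - b) \<bullet> (A v - A u)"
    by (metis adjoint_works assms(2) inner_commute linear_diff)
  show "0 \<le> f (A v - b) - f (A u - b) - adjoint A (G (A u - b)) \<bullet> (v - u) \<and>
        f (A v - b) - f (A u - b) - adjoint A (G (A u - b)) \<bullet> (v - u) \<le> q (A (v - u)) / 2"
    using bregman_boundedD(1)[OF assms(1), of "A u - b" "A v - b"] bregman_boundedD(2)[OF assms(1), of "A v - b" "A u - b"]
    unfolding * by (simp add: linear_diff[OF assms(2)])
qed

text \<open>The linearization error at \<open>u\<close> is quadratic in the displacement, so \<open>G u\<close> is the Frechet gradient.\<close>

lemma gradient_bregman_bounded:
  assumes "bregman_bounded f G (\<lambda>h. L * (norm h)\<^sup>2)"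
  shows "gradient f u = G u"
proof -
  have "GDERIV f u :> G u"
    unfolding gderiv_def has_derivative_iff_norm
  proof (intro conjI)
    show "bounded_linear (\<lambda>h. h \<bullet> G u)" by (rule bounded_linear_inner_left)
    have bound: "norm (f v - f u - (v - u) \<bullet> G u) / norm (v - u) \<le> L / 2 * norm (v - u)" for v
    proof (cases "v = u")
      case False
      have "norm (f v - f u - (v - u) \<bullet> G u) \<le> L * (norm (v - u))\<^sup>2 / 2"
        using bregman_boundedD(1)[OF assms, of u v] bregman_boundedD(2)[OF assms, of v u] by (simp add: inner_commute)
      then show ?thesis
        using False by (simp add: divide_le_eq power2_eq_square mult.assoc)
    qed simp
    have "((\<lambda>v. L / 2 * norm (v - u)) \<longlongrightarrow> L / 2 * norm (u - u)) (at u)"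
      by (intro tendsto_intros)
    then have lim: "((\<lambda>v. L / 2 * norm (v - u)) \<longlongrightarrow> 0) (at u)" by simp
    show "((\<lambda>v. norm (f v - f u - (v - u) \<bullet> G u) / norm (v - u)) \<longlongrightarrow> 0) (at u)"
      by (rule tendsto_sandwich[OF _ _ tendsto_const lim])
        (simp, rule always_eventually, rule allI, rule bound)
  qed
  moreover have "g = G u" if "GDERIV f u :> g" for g
  proof -
    have "(\<lambda>h. h \<bullet> g) = (\<lambda>h. h \<bullet> G u)"
      using has_derivative_unique that calculation unfolding gderiv_def by blast
    then have "\<forall>h. h \<bullet> g = h \<bullet> G u" by metis
    then show ?thesis using vector_eq_rdot by (metis inner_commute)
  qed
  ultimately show ?thesis unfolding gradient_def by (rule the_equality)
qed

section \<open>Accelerated projected gradient iterations\<close>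

text \<open>The point \<open>p\<close> minimizes over \<open>Z\<close> a quadratic model of \<open>f\<close> that has curvature \<open>L\<close>; the variational
  inequality of the projection expresses the resulting quadratic growth \<open>L / 2 * (norm (u - p))\<^sup>2\<close>.
  The model majorizes \<open>f\<close> at \<open>p\<close>, and its linear part minorizes \<open>f\<close> at \<open>u\<close>. Both bounds are global, so
  \<open>v\<close> may lie outside \<open>Z\<close>, as extrapolated points do.\<close>

lemma projected_gradient_step:
  fixes f :: "'a::euclidean_space \<Rightarrow> real"
  assumes "bregman_bounded f G (\<lambda>h. L * (norm h)\<^sup>2)" and "L > 0"
    and "convex Z" and "closed Z" and "u \<in> Z"
    and p: "p = closest_point Z (v - (1 / L) *\<^sub>R G v)"
  shows "f p + L / 2 * (norm (u - p))\<^sup>2 \<le> f u + L / 2 * (norm (u - v))\<^sup>2"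
proof -
  have "(v - (1 / L) *\<^sub>R G v - p) \<bullet> (u - p) \<le> 0"
    unfolding p using assms by (intro closest_point_dot)
  then have "L * ((v - (1 / L) *\<^sub>R G v - p) \<bullet> (u - p)) \<le> 0"
    using \<open>L > 0\<close> by (simp add: mult_le_0_iff)
  then have vi: "L * ((v - p) \<bullet> (u - p)) \<le> G v \<bullet> (u - p)"
    using \<open>L > 0\<close> by (simp add: inner_diff_left algebra_simps)
  have "(norm (u - v))\<^sup>2 = (norm (u - p))\<^sup>2 + (norm (p - v))\<^sup>2 - 2 * ((v - p) \<bullet> (u - p))"
    by (simp add: power2_norm_eq_inner inner_diff_left inner_diff_right inner_commute)
  then have "L / 2 * (norm (u - v))\<^sup>2
      = L / 2 * ((norm (u - p))\<^sup>2 + (norm (p - v))\<^sup>2 - 2 * ((v - p) \<bullet> (u - p)))" by simp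
  then have "L / 2 * (norm (u - v))\<^sup>2 = L / 2 * (norm (u - p))\<^sup>2 + L * (norm (p - v))\<^sup>2 / 2
      - L * ((v - p) \<bullet> (u - p))"
    by (simp add: distrib_left right_diff_distrib)
  moreover have "G v \<bullet> (u - p) = G v \<bullet> (u - v) - G v \<bullet> (p - v)"
    by (simp add: inner_diff_right)
  ultimately show ?thesis
    using vi bregman_boundedD(1)[OF assms(1), of v u] bregman_boundedD(2)[OF assms(1), of p v]
    by linarith
qed

lemma bregman_bounded_convex:
  assumes "bregman_bounded f G q" and "0 \<le> c" and "c \<le> 1"
  shows "f ((1 - c) *\<^sub>R u + c *\<^sub>R v) \<le> (1 - c) * f u + c * f v"
proof -
  let ?m = "(1 - c) *\<^sub>R u + c *\<^sub>R v"
  have "(1 - c) * (f ?m + G ?m \<bullet> (u - ?m)) + c * (f ?m + G ?m \<bullet> (v - ?m))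
      \<le> (1 - c) * f u + c * f v"
    using bregman_boundedD(1)[OF assms(1)] assms(2,3) by (intro add_mono mult_left_mono) auto
  moreover have "(1 - c) * (f ?m + G ?m \<bullet> (u - ?m)) + c * (f ?m + G ?m \<bullet> (v - ?m)) = f ?m"
    by (simp add: inner_diff_right inner_add_right algebra_simps)
  ultimately show ?thesis by simp
qed

text \<open>The previous inequality at \<open>u = (1 - 1 / \<tau>) *\<^sub>R x + (1 / \<tau>) *\<^sub>R s\<close>, multiplied by \<open>\<tau>\<^sup>2\<close>. Mixing in
  the weight \<open>1 - 1 / \<tau>\<close> on the old iterate is what trades a decrease of the cost gap
  against the distance to \<open>s\<close>.\<close>

lemma accelerated_step:
  fixes f :: "'a::euclidean_space \<Rightarrow> real"
  assumes f: "bregman_bounded f G (\<lambda>h. L * (norm h)\<^sup>2)" and "L > 0"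
    and Z: "convex Z" "closed Z" and "x \<in> Z" and "s \<in> Z" and "\<tau> \<ge> 1"
    and p: "p = closest_point Z (v - (1 / L) *\<^sub>R G v)"
  shows "\<tau>\<^sup>2 * (f p - f s) + L / 2 * (norm (s + (\<tau> - 1) *\<^sub>R x - \<tau> *\<^sub>R p))\<^sup>2
    \<le> (\<tau>\<^sup>2 - \<tau>) * (f x - f s) + L / 2 * (norm (s + (\<tau> - 1) *\<^sub>R x - \<tau> *\<^sub>R v))\<^sup>2"
proof -
  define u where "u = (1 - 1 / \<tau>) *\<^sub>R x + (1 / \<tau>) *\<^sub>R s"
  have "u \<in> Z"
    unfolding u_def using assms by (intro convexD) auto
  have \<tau>u: "\<tau> *\<^sub>R (u - w) = s + (\<tau> - 1) *\<^sub>R x - \<tau> *\<^sub>R w" for w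
    using \<open>\<tau> \<ge> 1\<close> by (simp add: u_def algebra_simps)
  have sq: "(norm (s + (\<tau> - 1) *\<^sub>R x - \<tau> *\<^sub>R w))\<^sup>2 = \<tau>\<^sup>2 * (norm (u - w))\<^sup>2" for w
    by (simp flip: \<tau>u add: power_mult_distrib)
  have "f p + L / 2 * (norm (u - p))\<^sup>2 \<le> f u + L / 2 * (norm (u - v))\<^sup>2"
    using projected_gradient_step[OF f \<open>L > 0\<close> Z \<open>u \<in> Z\<close> p] .
  also have "f u \<le> (1 - 1 / \<tau>) * f x + 1 / \<tau> * f s"
    unfolding u_def using \<open>\<tau> \<ge> 1\<close> by (intro bregman_bounded_convex[OF f]) auto
  finally have "f p + L / 2 * (norm (u - p))\<^sup>2
      \<le> (1 - 1 / \<tau>) * f x + 1 / \<tau> * f s + L / 2 * (norm (u - v))\<^sup>2" by simp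
  then have "\<tau>\<^sup>2 * (f p + L / 2 * (norm (u - p))\<^sup>2)
      \<le> \<tau>\<^sup>2 * ((1 - 1 / \<tau>) * f x + 1 / \<tau> * f s + L / 2 * (norm (u - v))\<^sup>2)"
    by (intro mult_left_mono) auto
  moreover have "\<tau>\<^sup>2 * ((1 - 1 / \<tau>) * f x + 1 / \<tau> * f s + L / 2 * (norm (u - v))\<^sup>2)
      = (\<tau>\<^sup>2 - \<tau>) * f x + \<tau> * f s + L / 2 * (\<tau>\<^sup>2 * (norm (u - v))\<^sup>2)"
    using \<open>\<tau> \<ge> 1\<close> by (simp add: field_simps power2_eq_square)
  ultimately show ?thesis
    unfolding sq by (simp add: algebra_simps)
qed

text \<open>The weights \<open>\<tau> k = (k + 1) / 2\<close> satisfy \<open>(\<tau> (k + 1))\<^sup>2 - \<tau> (k + 1) \<le> (\<tau> k)\<^sup>2\<close>, so the cost gap left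
  over by one step is covered by the potential \<open>V\<close> of the preceding one, and
  \<open>(\<tau> (k - 1) - 1) / \<tau> k = (k - 2) / (k + 1)\<close> is the prescribed momentum factor.\<close>

theorem accelerated_projected_gradient:
  fixes f :: "'a::euclidean_space \<Rightarrow> real"
  assumes f: "bregman_bounded f G (\<lambda>h. L * (norm h)\<^sup>2)" and "L > 0"
    and Z: "convex Z" "closed Z"
    and z: "sync_iterates f Z L z"
    and s: "s \<in> Z" "\<And>u. u \<in> Z \<Longrightarrow> f s \<le> f u"
    and "t \<ge> 1"
  shows "f (z t) - f s \<le> 2 * L / (real_of_int t + 1)\<^sup>2 * (norm (z 0 - s))\<^sup>2"
proof -
  define \<zeta> where "\<zeta> k = z (k - 1) + ((real_of_int k - 2) / (real_of_int k + 1)) *\<^sub>R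
    (z (k - 1) - z (k - 2))" for k
  have z0: "z 0 \<in> Z" "z (-1) = z 0"
    using z by (auto simp: sync_iterates_def)
  have step: "z k = closest_point Z (\<zeta> k - (1 / L) *\<^sub>R G (\<zeta> k))" if "k \<ge> 1" for k
    using z that
    by (auto simp: sync_iterates_def Let_def \<zeta>_def gradient_bregman_bounded[OF f])
  have z_in: "z k \<in> Z" if "k \<ge> 0" for k
    using that z0(1) step[of k] closest_point_in_set[OF Z(2)] s(1) by (cases "k = 0") auto
  define \<tau> where "\<tau> k = (real_of_int k + 1) / 2" for k
  define V where "V k = (\<tau> k)\<^sup>2 * (f (z k) - f s)
    + L / 2 * (norm (s + (\<tau> k - 1) *\<^sub>R z (k - 1) - \<tau> k *\<^sub>R z k))\<^sup>2" for k
  have momentum: "s + (\<tau> k - 1) *\<^sub>R z (k - 1) - \<tau> k *\<^sub>R \<zeta> k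
      = s + (\<tau> (k - 1) - 1) *\<^sub>R z (k - 2) - \<tau> (k - 1) *\<^sub>R z (k - 1)" if "k \<ge> 1" for k
  proof -
    have "\<tau> k *\<^sub>R \<zeta> k = \<tau> k *\<^sub>R z (k - 1) + (\<tau> (k - 1) - 1) *\<^sub>R (z (k - 1) - z (k - 2))"
    proof -
      have "\<tau> k * ((real_of_int k - 2) / (real_of_int k + 1)) = \<tau> (k - 1) - 1"
        using that by (simp add: \<tau>_def divide_simps)
      then show ?thesis by (simp add: \<zeta>_def scaleR_add_right)
    qed
    then show ?thesis by (simp add: algebra_simps)
  qed
  have V_step: "V k \<le> ((\<tau> k)\<^sup>2 - \<tau> k) * (f (z (k - 1)) - f s)
      + L / 2 * (norm (s + (\<tau> (k - 1) - 1) *\<^sub>R z (k - 2) - \<tau> (k - 1) *\<^sub>R z (k - 1)))\<^sup>2"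
    if "k \<ge> 1" for k
    using accelerated_step[OF f \<open>L > 0\<close> Z z_in[of "k - 1"] s(1) _ step[OF that], of "\<tau> k"] that
    unfolding V_def momentum[OF that] by (simp add: \<tau>_def)
  have "V t \<le> L / 2 * (norm (z 0 - s))\<^sup>2"
    using \<open>t \<ge> 1\<close>
  proof (induction t rule: int_ge_induct)
    case base
    have init: "s + (\<tau> 0 - 1) *\<^sub>R z (-1) - \<tau> 0 *\<^sub>R z 0 = s - z 0"
      using z0(2) by (simp add: \<tau>_def algebra_simps flip: scaleR_add_left)
    \<comment> \<open>The cost gap at time 0 gets the weight \<open>(\<tau> 1)\<^sup>2 - \<tau> 1 = 0\<close>, so the final bound depends on
      the starting point only through its distance to \<open>s\<close>.\<close>
    have "V 1 \<le> ((\<tau> 1)\<^sup>2 - \<tau> 1) * (f (z 0) - f s)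
        + L / 2 * (norm (s + (\<tau> 0 - 1) *\<^sub>R z (-1) - \<tau> 0 *\<^sub>R z 0))\<^sup>2"
      using V_step[of 1] by simp
    moreover have "\<tau> 1 = 1" by (simp add: \<tau>_def)
    ultimately show ?case
      unfolding init by (simp add: norm_minus_commute)
  next
    case (step k)
    have "(\<tau> (k + 1))\<^sup>2 - \<tau> (k + 1) \<le> (\<tau> k)\<^sup>2"
      by (simp add: \<tau>_def power2_eq_square field_simps)
    moreover have "0 \<le> f (z k) - f s"
      using s(2)[OF z_in[of k]] step by simp
    ultimately have "V (k + 1) \<le> V k"
      using V_step[of "k + 1"] step mult_right_mono[of "(\<tau> (k + 1))\<^sup>2 - \<tau> (k + 1)" "(\<tau> k)\<^sup>2" "f (z k) - f s"]
      by (simp add: V_def)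
    then show ?case using step by simp
  qed
  moreover have "(\<tau> t)\<^sup>2 * (f (z t) - f s) \<le> V t"
    using \<open>L > 0\<close> by (simp add: V_def)
  ultimately have "(\<tau> t)\<^sup>2 * (f (z t) - f s) \<le> L / 2 * (norm (z 0 - s))\<^sup>2" by simp
  moreover have "(\<tau> t)\<^sup>2 > 0" using \<open>t \<ge> 1\<close> by (simp add: \<tau>_def)
  ultimately have "f (z t) - f s \<le> L / 2 * (norm (z 0 - s))\<^sup>2 / (\<tau> t)\<^sup>2"
    by (simp add: pos_le_divide_eq mult.commute)
  also have "\<dots> = 2 * L / (real_of_int t + 1)\<^sup>2 * (norm (z 0 - s))\<^sup>2"
    by (simp add: \<tau>_def power_divide)
  finally show ?thesis .
qed

section \<open>The Huber function\<close>

text \<open>The projection onto the centred ball of radius \<open>\<delta>\<close>, in closed form; it is the gradient of half the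
  Huber function.\<close>

definition ball_projection :: "real \<Rightarrow> 'a::real_inner \<Rightarrow> 'a" where
  "ball_projection \<delta> u = (if norm u \<le> \<delta> then u else (\<delta> / norm u) *\<^sub>R u)"

lemma norm_ball_projection: "\<delta> > 0 \<Longrightarrow> norm (ball_projection \<delta> u) \<le> \<delta>"
  by (simp add: ball_projection_def)

text \<open>The first identity says that the maximum in the dual representation of the Huber function is
  attained at the projection. The second is the normal cone condition: the residual
  is either zero or parallel to a projection of norm \<open>\<delta>\<close>.\<close>

lemma huber_norm_ball_projection:
  assumes "\<delta> > 0"
  shows "huber_norm \<delta> u / 2 = ball_projection \<delta> u \<bullet> u - (norm (ball_projection \<delta> u))\<^sup>2 / 2"
    and "ball_projection \<delta> u \<bullet> (u - ball_projection \<delta> u) = \<delta> * norm (u - ball_projection \<delta> u)"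
proof -
  show "huber_norm \<delta> u / 2 = ball_projection \<delta> u \<bullet> u - (norm (ball_projection \<delta> u))\<^sup>2 / 2"
    using assms
    by (auto simp: huber_norm_def huber_def ball_projection_def power2_norm_eq_inner[symmetric])
      (simp add: field_simps power2_eq_square)
  show "ball_projection \<delta> u \<bullet> (u - ball_projection \<delta> u) = \<delta> * norm (u - ball_projection \<delta> u)"
  proof (cases "norm u \<le> \<delta>")
    case False
    then have "u - ball_projection \<delta> u = (1 - \<delta> / norm u) *\<^sub>R u" and "0 \<le> 1 - \<delta> / norm u"
      using assms by (auto simp: ball_projection_def algebra_simps divide_le_eq)
    then show ?thesis
      using False assms
      by (simp add: ball_projection_def power2_norm_eq_inner[symmetric] power2_eq_square)
  qed (simp add: ball_projection_def)
qed

lemma huber_norm_lower: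
  assumes "norm g \<le> \<delta>"
  shows "g \<bullet> v - (norm g)\<^sup>2 / 2 \<le> huber_norm \<delta> v / 2"
proof -
  have cs: "g \<bullet> v \<le> norm g * norm v" by (rule norm_cauchy_schwarz)
  show ?thesis
  proof (cases "norm v \<le> \<delta>")
    case True
    have "0 \<le> (norm g - norm v)\<^sup>2" by simp
    then show ?thesis
      using True cs by (simp add: huber_norm_def huber_def power2_eq_square algebra_simps)
  next
    case False
    then have "0 \<le> (\<delta> - norm g) * (2 * norm v - \<delta> - norm g)"
      using assms by (intro mult_nonneg_nonneg) auto
    then show ?thesis
      using False cs by (simp add: huber_norm_def huber_def power2_eq_square algebra_simps)
  qed
qed

text \<open>Both halves come from the dual representation. Convexity is the bound at \<open>v\<close> with the multiplier
  that is optimal at \<open>u\<close>. For the upper half, the optimal multiplier \<open>k\<close> at \<open>v\<close> is tested on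
  \<open>v = (v - u + g) + (u - g)\<close>, where \<open>g\<close> is optimal at \<open>u\<close>: the first part is handled by completing the square,
  the second by \<open>norm k \<le> \<delta>\<close> and the normal cone condition.\<close>

lemma bregman_bounded_huber:
  assumes "\<delta> > 0"
  shows "bregman_bounded (\<lambda>u. 1/2 * huber_norm \<delta> u) (ball_projection \<delta>) (\<lambda>h. (norm h)\<^sup>2)"
  unfolding bregman_bounded_def
proof (intro allI conjI)
  fix u v :: 'a
  let ?g = "ball_projection \<delta> u" and ?k = "ball_projection \<delta> v"
  show "0 \<le> 1/2 * huber_norm \<delta> v - 1/2 * huber_norm \<delta> u - ?g \<bullet> (v - u)"
    using huber_norm_lower[OF norm_ball_projection[OF assms], of u v]
      huber_norm_ball_projection(1)[OF assms, of u]
    by (simp add: inner_diff_right diff_divide_distrib)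
  have "?k \<bullet> (u - ?g) \<le> norm ?k * norm (u - ?g)" by (rule norm_cauchy_schwarz)
  also have "\<dots> \<le> \<delta> * norm (u - ?g)"
    using norm_ball_projection[OF assms] by (rule mult_right_mono) simp
  also have "\<dots> = ?g \<bullet> (u - ?g)" by (rule huber_norm_ball_projection(2)[OF assms, symmetric])
  finally have 1: "?k \<bullet> (u - ?g) \<le> ?g \<bullet> (u - ?g)" .
  have "?k \<bullet> (h + ?g) - (norm ?k)\<^sup>2 / 2 \<le> (norm h)\<^sup>2 / 2 + ?g \<bullet> h + (norm ?g)\<^sup>2 / 2" for h
  proof -
    have "0 \<le> (norm (?k - (h + ?g)))\<^sup>2" by simp
    then show ?thesis
      unfolding power2_norm_eq_inner
      by (simp add: inner_diff_left inner_diff_right inner_add_left inner_add_right inner_commute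
          algebra_simps)
  qed
  from this[of "v - u"]
  have 2: "?k \<bullet> (v - u + ?g) - (norm ?k)\<^sup>2 / 2
      \<le> (norm (v - u))\<^sup>2 / 2 + ?g \<bullet> (v - u) + (norm ?g)\<^sup>2 / 2" .
  have 3: "?k \<bullet> (v - u + ?g) = ?k \<bullet> v - ?k \<bullet> (u - ?g)"
    by (simp add: inner_diff_right inner_add_right)
  have 4: "?g \<bullet> (u - ?g) = ?g \<bullet> u - (norm ?g)\<^sup>2"
    by (simp add: inner_diff_right power2_norm_eq_inner)
  show "1/2 * huber_norm \<delta> v - 1/2 * huber_norm \<delta> u - ?g \<bullet> (v - u) \<le> (norm (v - u))\<^sup>2 / 2"
    using 1 2 huber_norm_ball_projection(1)[OF assms, of u] huber_norm_ball_projection(1)[OF assms, of v]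
    by (simp only: 3 4)
qed

section \<open>The localization cost\<close>

text \<open>An orientation and its converse partition the adjacency pairs, so every node
  is counted once for each of its neighbours.\<close>

lemma sum_orientation_endpoints:
  fixes f :: "'v::finite \<Rightarrow> real"
  assumes "orientation adj E"
  shows "(\<Sum>(i, j)\<in>E. f i + f j) = (\<Sum>i\<in>UNIV. real (node_degree adj i) * f i)"
proof -
  have fin: "finite S" for S :: "('v \<times> 'v) set" by simp
  have "(\<Sum>(i, j)\<in>E. f i + f j) = (\<Sum>e\<in>E. f (fst e)) + (\<Sum>e\<in>E. f (snd e))"
    by (simp add: split_def sum.distrib)
  also have "(\<Sum>e\<in>E. f (snd e)) = (\<Sum>e\<in>E\<inverse>. f (fst e))"
    by (rule sum.reindex_bij_witness[of _ prod.swap prod.swap]) auto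
  also have "(\<Sum>e\<in>E. f (fst e)) + (\<Sum>e\<in>E\<inverse>. f (fst e)) = (\<Sum>e\<in>E \<union> E\<inverse>. f (fst e))"
    using assms
    by (intro sum.union_disjoint[symmetric] fin) (auto simp: orientation_def dest: asymD)
  also have "E \<union> E\<inverse> = Sigma UNIV (\<lambda>i. {j. adj i j})"
    using assms by (auto simp: orientation_def)
  also have "(\<Sum>e\<in>Sigma UNIV (\<lambda>i. {j. adj i j}). f (fst e)) = (\<Sum>i\<in>UNIV. \<Sum>j\<in>{j. adj i j}. f i)"
    by (subst sum.Sigma) (auto simp: split_def)
  finally show ?thesis by (simp add: node_degree_def)
qed

lemma norm_diff_square_le:
  fixes u v :: "'a::real_inner"
  assumes "s > 0"
  shows "(norm (u - v))\<^sup>2 \<le> (1 + 1 / s) * (norm u)\<^sup>2 + (1 + s) * (norm v)\<^sup>2"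
proof -
  have "0 \<le> (norm (u + s *\<^sub>R v))\<^sup>2 / s" using assms by simp
  also have "\<dots> = (norm u)\<^sup>2 / s + 2 * (u \<bullet> v) + s * (norm v)\<^sup>2"
    using assms
    by (simp add: power2_norm_eq_inner inner_add_left inner_add_right inner_commute field_simps)
  finally show ?thesis
    by (simp add: power2_norm_eq_inner inner_diff_left inner_diff_right inner_commute algebra_simps)
qed

lemma norm_vec_square: "(norm (x::'a::real_normed_vector^'n::finite))\<^sup>2 = (\<Sum>i\<in>UNIV. (norm (x $ i))\<^sup>2)"
  by (simp add: norm_vec_def L2_set_def sum_nonneg)

text \<open>The linear parts of the residuals in the cost, one for each range measurement.\<close>

definition edge_map :: "'v \<times> 'v \<Rightarrow> ('p::finite, 'v::finite, 'k::finite) var \<Rightarrow> real^'p" where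
  "edge_map e = (\<lambda>(x, y, w). x $ fst e - x $ snd e - y $ e)"

definition anchor_map :: "'v \<times> 'k \<Rightarrow> ('p::finite, 'v::finite, 'k::finite) var \<Rightarrow> real^'p" where
  "anchor_map c = (\<lambda>(x, y, w). x $ fst c - w $ c)"

lemma linear_edge_map: "linear (edge_map e)"
  by (rule linearI) (auto simp: edge_map_def algebra_simps)

lemma linear_anchor_map: "linear (anchor_map c)"
  by (rule linearI) (auto simp: anchor_map_def algebra_simps)

text \<open>The operator norm bound behind \<open>L_F\<close>. With \<open>M = L_F adj \<A> - 2\<close>, the squares in \<open>x\<close> alone sum to at
  most \<open>M * (norm x)\<^sup>2\<close>. Young's inequality with parameter \<open>1 + M\<close> gives \<open>y\<close> and \<open>w\<close> the factor \<open>2 + M\<close>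
  and \<open>x\<close> the factor \<open>(1 + 1 / (1 + M)) * M\<close>, and neither exceeds \<open>L_F adj \<A>\<close>. The parameter stays
  positive when there are neither edges nor anchors.\<close>

lemma measurement_maps_bound:
  fixes h :: "('p::finite, 'v::finite, 'k::finite) var"
  assumes "orientation adj E"
  shows "(\<Sum>e\<in>E. (norm (edge_map e h))\<^sup>2) + (\<Sum>c\<in>Sigma UNIV \<A>. (norm (anchor_map c h))\<^sup>2)
    \<le> L_F adj \<A> * (norm h)\<^sup>2"
proof -
  obtain x y w where h: "h = (x, y, w)" by (cases h)
  define M where "M = 2 * real (max_degree adj) + real (Max (range (\<lambda>i. card (\<A> i))))"
  define c where "c = 1 + 1 / (1 + M)"
  have "M \<ge> 0" by (simp add: M_def)
  then have "c \<ge> 0" by (simp add: c_def)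
  have L: "L_F adj \<A> = 1 + (1 + M)" by (simp add: L_F_def M_def)
  have young: "(norm (u - v))\<^sup>2 \<le> c * (norm u)\<^sup>2 + L_F adj \<A> * (norm v)\<^sup>2" for u v :: "real^'p"
    unfolding c_def L using \<open>M \<ge> 0\<close> by (intro norm_diff_square_le) simp
  have edge: "(norm (edge_map e h))\<^sup>2
      \<le> 2 * c * ((norm (x $ fst e))\<^sup>2 + (norm (x $ snd e))\<^sup>2) + L_F adj \<A> * (norm (y $ e))\<^sup>2" for e
  proof -
    have "(norm (x $ fst e - x $ snd e))\<^sup>2 \<le> 2 * ((norm (x $ fst e))\<^sup>2 + (norm (x $ snd e))\<^sup>2)"
      using norm_diff_square_le[of 1 "x $ fst e" "x $ snd e"] by simp
    from mult_left_mono[OF this \<open>c \<ge> 0\<close>] show ?thesis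
      using young[of "x $ fst e - x $ snd e" "y $ e"] by (simp add: edge_map_def h distrib_left)
  qed
  have "(\<Sum>e\<in>E. (norm (edge_map e h))\<^sup>2)
      \<le> (\<Sum>e\<in>E. 2 * c * ((norm (x $ fst e))\<^sup>2 + (norm (x $ snd e))\<^sup>2) + L_F adj \<A> * (norm (y $ e))\<^sup>2)"
    by (intro sum_mono edge)
  also have "\<dots> = 2 * c * (\<Sum>i\<in>UNIV. real (node_degree adj i) * (norm (x $ i))\<^sup>2)
      + L_F adj \<A> * (\<Sum>e\<in>E. (norm (y $ e))\<^sup>2)"
    unfolding sum_orientation_endpoints[OF assms, symmetric] split_def
    by (subst sum.distrib) (simp only: sum_distrib_left)
  also have "(\<Sum>e\<in>E. (norm (y $ e))\<^sup>2) \<le> (norm y)\<^sup>2"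
    unfolding norm_vec_square[of y] by (intro sum_mono2) auto
  finally have edges: "(\<Sum>e\<in>E. (norm (edge_map e h))\<^sup>2)
      \<le> 2 * c * (\<Sum>i\<in>UNIV. real (node_degree adj i) * (norm (x $ i))\<^sup>2) + L_F adj \<A> * (norm y)\<^sup>2"
    using \<open>M \<ge> 0\<close> L by (simp add: mult_left_mono)
  have "(\<Sum>c\<in>Sigma UNIV \<A>. (norm (anchor_map c h))\<^sup>2)
      \<le> (\<Sum>e\<in>Sigma UNIV \<A>. c * (norm (x $ fst e))\<^sup>2 + L_F adj \<A> * (norm (w $ e))\<^sup>2)"
    by (intro sum_mono) (simp add: anchor_map_def h young)
  also have "\<dots> = c * (\<Sum>i\<in>UNIV. real (card (\<A> i)) * (norm (x $ i))\<^sup>2)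
      + L_F adj \<A> * (\<Sum>e\<in>Sigma UNIV \<A>. (norm (w $ e))\<^sup>2)"
  proof -
    have "(\<Sum>e\<in>Sigma UNIV \<A>. (norm (x $ fst e))\<^sup>2) = (\<Sum>i\<in>UNIV. \<Sum>k\<in>\<A> i. (norm (x $ i))\<^sup>2)"
      by (subst sum.Sigma) (auto simp: split_def)
    then show ?thesis by (simp add: sum.distrib flip: sum_distrib_left)
  qed
  also have "(\<Sum>e\<in>Sigma UNIV \<A>. (norm (w $ e))\<^sup>2) \<le> (norm w)\<^sup>2"
    unfolding norm_vec_square[of w] by (intro sum_mono2) auto
  finally have anchors: "(\<Sum>c\<in>Sigma UNIV \<A>. (norm (anchor_map c h))\<^sup>2)
      \<le> c * (\<Sum>i\<in>UNIV. real (card (\<A> i)) * (norm (x $ i))\<^sup>2) + L_F adj \<A> * (norm w)\<^sup>2"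
    using \<open>M \<ge> 0\<close> L by (simp add: mult_left_mono)
  have "2 * c * (\<Sum>i\<in>UNIV. real (node_degree adj i) * (norm (x $ i))\<^sup>2)
      + c * (\<Sum>i\<in>UNIV. real (card (\<A> i)) * (norm (x $ i))\<^sup>2)
      = (\<Sum>i\<in>UNIV. c * (2 * real (node_degree adj i) + real (card (\<A> i))) * (norm (x $ i))\<^sup>2)"
    by (simp add: sum_distrib_left sum.distrib[symmetric] algebra_simps)
  also have "\<dots> \<le> (\<Sum>i\<in>UNIV. L_F adj \<A> * (norm (x $ i))\<^sup>2)"
  proof (intro sum_mono mult_right_mono)
    fix i
    have "node_degree adj i \<le> max_degree adj" and "card (\<A> i) \<le> Max (range (\<lambda>i. card (\<A> i)))"
      unfolding max_degree_def by (intro Max_ge; simp)+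
    then have "2 * real (node_degree adj i) + real (card (\<A> i)) \<le> M"
      unfolding M_def by linarith
    then have "c * (2 * real (node_degree adj i) + real (card (\<A> i))) \<le> c * M"
      using \<open>c \<ge> 0\<close> by (rule mult_left_mono)
    also have "\<dots> \<le> L_F adj \<A>"
      using \<open>M \<ge> 0\<close> by (simp add: L c_def field_simps)
    finally show "c * (2 * real (node_degree adj i) + real (card (\<A> i))) \<le> L_F adj \<A>" .
  qed simp
  also have "\<dots> = L_F adj \<A> * (norm x)\<^sup>2"
    by (simp only: norm_vec_square[of x] sum_distrib_left)
  finally have "(\<Sum>e\<in>E. (norm (edge_map e h))\<^sup>2) + (\<Sum>c\<in>Sigma UNIV \<A>. (norm (anchor_map c h))\<^sup>2)
      \<le> L_F adj \<A> * (norm x)\<^sup>2 + L_F adj \<A> * (norm y)\<^sup>2 + L_F adj \<A> * (norm w)\<^sup>2"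
    using edges anchors by linarith
  also have "\<dots> = L_F adj \<A> * (norm h)\<^sup>2"
    by (simp add: h norm_Pair algebra_simps)
  finally show ?thesis .
qed

lemma cost_bregman_bounded:
  fixes a :: "'k::finite \<Rightarrow> real^'p::finite" and E :: "('v::finite \<times> 'v) set"
  assumes "orientation adj E"
    and "\<And>i j. (i, j) \<in> E \<Longrightarrow> D i j > 0"
    and "\<And>i k. k \<in> \<A> i \<Longrightarrow> R i k > 0"
  shows "\<exists>G. bregman_bounded (cost E \<A> a D R) G (\<lambda>h. L_F adj \<A> * (norm h)\<^sup>2)"
proof -
  \<comment> \<open>The shift by 0 brings the edge terms into the affine form that the anchor terms have.\<close>
  have edge: "bregman_bounded (\<lambda>u. 1/2 * huber_norm (D (fst e) (snd e)) (edge_map e u - 0))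
      (\<lambda>u. adjoint (edge_map e) (ball_projection (D (fst e) (snd e)) (edge_map e u - 0)))
      (\<lambda>h. (norm (edge_map e h))\<^sup>2)" if "e \<in> E" for e
    using that assms(2)
    by (intro bregman_bounded_affine[OF bregman_bounded_huber linear_edge_map]) auto
  obtain G1 :: "('p, 'v, 'k) var \<Rightarrow> ('p, 'v, 'k) var" where G1: "bregman_bounded
      (\<lambda>u. \<Sum>e\<in>E. 1/2 * huber_norm (D (fst e) (snd e)) (edge_map e u - 0)) G1
      (\<lambda>h. \<Sum>e\<in>E. (norm (edge_map e h))\<^sup>2)"
    by (rule that[OF bregman_bounded_sum[OF finite edge]])
  have anchor: "bregman_bounded (\<lambda>u. 1/2 * huber_norm (R (fst c) (snd c)) (anchor_map c u - a (snd c)))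
      (\<lambda>u. adjoint (anchor_map c) (ball_projection (R (fst c) (snd c)) (anchor_map c u - a (snd c))))
      (\<lambda>h. (norm (anchor_map c h))\<^sup>2)" if "c \<in> Sigma UNIV \<A>" for c
    using that assms(3)
    by (intro bregman_bounded_affine[OF bregman_bounded_huber linear_anchor_map]) auto
  obtain G2 :: "('p, 'v, 'k) var \<Rightarrow> ('p, 'v, 'k) var" where G2: "bregman_bounded
      (\<lambda>u. \<Sum>c\<in>Sigma UNIV \<A>. 1/2 * huber_norm (R (fst c) (snd c)) (anchor_map c u - a (snd c))) G2
      (\<lambda>h. \<Sum>c\<in>Sigma UNIV \<A>. (norm (anchor_map c h))\<^sup>2)"
    by (rule that[OF bregman_bounded_sum[OF finite anchor]])
  have "cost E \<A> a D R =
      (\<lambda>u. (\<Sum>e\<in>E. 1/2 * huber_norm (D (fst e) (snd e)) (edge_map e u - 0))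
        + (\<Sum>c\<in>Sigma UNIV \<A>. 1/2 * huber_norm (R (fst c) (snd c)) (anchor_map c u - a (snd c))))"
  proof (rule ext)
    fix u :: "('p, 'v, 'k) var"
    obtain x y w where u: "u = (x, y, w)" by (cases u)
    have "(\<Sum>i\<in>UNIV. \<Sum>k\<in>\<A> i. 1/2 * huber_norm (R i k) (x $ i - a k - w $ (i, k)))
        = (\<Sum>c\<in>Sigma UNIV \<A>. 1/2 * huber_norm (R (fst c) (snd c)) (anchor_map c u - a (snd c)))"
      by (subst sum.Sigma) (auto simp: anchor_map_def u split_def diff_diff_eq add.commute)
    then show "cost E \<A> a D R u =
        (\<Sum>e\<in>E. 1/2 * huber_norm (D (fst e) (snd e)) (edge_map e u - 0))
        + (\<Sum>c\<in>Sigma UNIV \<A>. 1/2 * huber_norm (R (fst c) (snd c)) (anchor_map c u - a (snd c)))"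
      by (simp add: cost_def edge_map_def u split_def)
  qed
  with bregman_bounded_mono[OF bregman_bounded_add[OF G1 G2] measurement_maps_bound[OF assms(1)]]
  have "bregman_bounded (cost E \<A> a D R) (\<lambda>u. G1 u + G2 u) (\<lambda>h. L_F adj \<A> * (norm h)\<^sup>2)"
    by (simp only:)
  then show ?thesis by (intro exI)
qed

text \<open>The feasible set is an intersection of preimages of balls (for padding entries, of the origin)
  under coordinate projections.\<close>

lemma convex_closed_feasible:
  fixes E :: "('v::finite \<times> 'v) set" and \<A> :: "'v \<Rightarrow> 'k::finite set"
  shows "convex (feasible E \<A> d r :: ('p::finite, 'v, 'k) var set)"
    and "closed (feasible E \<A> d r :: ('p::finite, 'v, 'k) var set)"
proof -
  let ?B = "\<lambda>i j. if (i, j) \<in> E then cball 0 (d i j) else {0 :: real^'p}"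
  let ?C = "\<lambda>i k. if k \<in> \<A> i then cball 0 (r i k) else {0 :: real^'p}"
  have eq: "feasible E \<A> d r = (\<Inter>i. \<Inter>j. (\<lambda>z. fst (snd z) $ (i, j)) -` ?B i j)
      \<inter> (\<Inter>i. \<Inter>k. (\<lambda>z. snd (snd z) $ (i, k)) -` ?C i k)"
  proof (rule set_eqI)
    fix z :: "('p, 'v, 'k) var"
    show "z \<in> feasible E \<A> d r \<longleftrightarrow>
        z \<in> (\<Inter>i. \<Inter>j. (\<lambda>z. fst (snd z) $ (i, j)) -` ?B i j)
          \<inter> (\<Inter>i. \<Inter>k. (\<lambda>z. snd (snd z) $ (i, k)) -` ?C i k)"
      by (cases z) (simp add: feasible_def if_distrib[of "\<lambda>S. _ \<in> S"] cong: if_cong, meson)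
  qed
  have lin1: "linear (\<lambda>z :: ('p, 'v, 'k) var. fst (snd z) $ c)" for c
    by (rule linearI) auto
  have lin2: "linear (\<lambda>z :: ('p, 'v, 'k) var. snd (snd z) $ c)" for c
    by (rule linearI) auto
  show "convex (feasible E \<A> d r :: ('p, 'v, 'k) var set)"
    unfolding eq by (intro convex_Int convex_INT convex_linear_vimage lin1 lin2) auto
  show "closed (feasible E \<A> d r :: ('p, 'v, 'k) var set)"
    unfolding eq
    by (intro closed_Int closed_INT ballI continuous_closed_vimage linear_continuous_at
        linear_conv_bounded_linear[THEN iffD1] lin1 lin2) auto
qed

theorem mainTheorem4:
  fixes adj :: "'v::finite \<Rightarrow> 'v \<Rightarrow> bool"
    and E :: "('v \<times> 'v) set"
    and \<A> :: "'v \<Rightarrow> 'k::finite set"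
    and a :: "'k \<Rightarrow> real^'p::finite"
    and d D :: "'v \<Rightarrow> 'v \<Rightarrow> real"
    and r R :: "'v \<Rightarrow> 'k \<Rightarrow> real"
    and F :: "('p, 'v, 'k) var \<Rightarrow> real"
    and Z :: "('p, 'v, 'k) var set"
    and L :: real
    and z :: "int \<Rightarrow> ('p, 'v, 'k) var"
    and zstar :: "('p, 'v, 'k) var"
  assumes "CARD('p) = 2 \<or> CARD('p) = 3"
    and "simple_graph adj"
    and "orientation adj E"
    and "\<And>i j. (i, j) \<in> E \<Longrightarrow> d i j \<ge> 0"
    and "\<And>i j. (i, j) \<in> E \<Longrightarrow> D i j > 0"
    and "\<And>i k. k \<in> \<A> i \<Longrightarrow> r i k \<ge> 0"
    and "\<And>i k. k \<in> \<A> i \<Longrightarrow> R i k > 0"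
    and "F = cost E \<A> a D R"
    and "Z = feasible E \<A> d r"
    and "L = L_F adj \<A>"
    and "sync_iterates F Z L z"
    and "is_arg_min F (\<lambda>u. u \<in> Z) zstar"
  shows "\<forall>t\<ge>1. F (z t) - (INF u\<in>Z. F u) \<le> 2 * L / (real_of_int t + 1)\<^sup>2 * (norm (z 0 - zstar))\<^sup>2"
proof (intro allI impI)
  fix t :: int
  assume "t \<ge> 1"
  obtain G where G: "bregman_bounded F G (\<lambda>h. L * (norm h)\<^sup>2)"
    using cost_bregman_bounded[of adj E D \<A> R a] assms(3,5,7,8,10) by blast
  have "L > 0" by (simp add: assms(10) L_F_def)
  have Z: "convex Z" "closed Z"
    using convex_closed_feasible assms(9) by auto
  have zstar: "zstar \<in> Z" "\<And>u. u \<in> Z \<Longrightarrow> F zstar \<le> F u"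
    using assms(12) by (auto simp: is_arg_min_linorder)
  then have "(INF u\<in>Z. F u) = F zstar"
    by (intro cInf_eq_minimum) auto
  then show "F (z t) - (INF u\<in>Z. F u) \<le> 2 * L / (real_of_int t + 1)\<^sup>2 * (norm (z 0 - zstar))\<^sup>2"
    using accelerated_projected_gradient[OF G \<open>L > 0\<close> Z assms(11) zstar \<open>t \<ge> 1\<close>] by simp
qed

end
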